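(* If a permutation $w \in S_n$ is the column reading word of a standard tableau (equivalently, if the Robinson--Schensted recording tableau $Q(w)$ is a column superstandard tableau), then the steady-state time of $w$ is $0$ or $1$.
   Context: A tableau is standard if its rows and columns are increasing and each of $1,\dots,n$ appears exactly once. The column reading word of a tableau $T$ is the word obtained by reading the columns of $T$ from bottom to top, taking the columns from left to right. The column superstandard tableau of shape $\lambda$ is the tableau of shape $\lambda$ obtained by filling the columns top to bottom, from left to right, with $1,2,3,\dots,n$ in this order. Box-ball system (BBS). Boxes are indexed by $\mathbb{Z}$ from left to right. A BBS configuration (with $n$ balls) is a sequence $X$ indexed by $\mathbb{Z}$ in which each of $1,\dots,n$ (the balls) appears exactly once and every other entry is $e := n+1$ (an empty box). One BBS move transforms $X$ into $\mathrm{BB}(X)$: the balls $1,2,\dots,n$, in this order, each jump once, to the nearest box to the right of the ball that is empty at that moment (the box a ball leaves becomes empty). $\mathrm{BB}^t(X)$ is the result of $t$ BBS moves. A permutation $w = w_1\cdots w_n \in S_n$ (one-line notation) is regarded as the configuration with ball $w_i$ in box $i$ for $1\le i\le n$ and all other boxes empty. An increasing run of a configuration is a maximal contiguous (occupying consecutive boxes) increasing nonempty sequence of balls. A soliton is an increasing run that is preserved by all subsequent BBS moves (it remains an increasing run in all later configurations). A configuration is in steady state if every ball is contained in a soliton. The steady-state time of $w$ is the least $t\ge 0$ such that $\mathrm{BB}^t(w)$ is in steady state. *)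

theory Defs
  imports Main "HOL-Combinatorics.Multiset_Permutations" "HOL-Library.Extended_Nat"
begin

section \<open>Tableaux\<close>

text \<open>A tableau is the list of its rows, top row first (English convention). Words and
  permutations in one-line notation are lists; positions in lists count from 0.\<close>

type_synonym tableau = "nat list list"

definition shape :: "tableau \<Rightarrow> nat list" where
  "shape T = map length T"

definition integer_partition :: "nat list \<Rightarrow> bool" where
  "integer_partition \<mu> \<longleftrightarrow> sorted_wrt (\<ge>) \<mu> \<and> 0 \<notin> set \<mu>"

definition standard_tableau :: "nat \<Rightarrow> tableau \<Rightarrow> bool" where
  "standard_tableau n T \<longleftrightarrow>
     integer_partition (shape T) \<and>
     (\<forall>r\<in>set T. sorted_wrt (<) r) \<and>
     (\<forall>c\<in>set (List.transpose T). sorted_wrt (<) c) \<and>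
     distinct (concat T) \<and> set (concat T) = {1..n}"

text \<open>For a tableau of partition shape, \<^const>\<open>List.transpose\<close> yields the columns from left to right,
  each of them listed from top to bottom.\<close>

definition column_reading_word :: "tableau \<Rightarrow> nat list" where
  "column_reading_word T = concat (map rev (List.transpose T))"

definition column_length :: "nat list \<Rightarrow> nat \<Rightarrow> nat" where
  "column_length \<mu> j = card {i \<in> {..<length \<mu>}. j < \<mu> ! i}"

text \<open>The box in row \<open>i\<close> and column \<open>j\<close> is preceded by all boxes of the columns to its left
  and by the \<open>i\<close> boxes above it in its own column.\<close>

definition column_superstandard :: "nat list \<Rightarrow> tableau" where
  "column_superstandard \<mu> =
     map (\<lambda>i. map (\<lambda>j. (\<Sum>k<j. column_length \<mu> k) + i + 1) [0..<\<mu> ! i]) [0..<length \<mu>]"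


section \<open>Robinson--Schensted row insertion\<close>

text \<open>Inserting \<open>x\<close> into a row replaces (bumps) the leftmost entry greater than \<open>x\<close>, if there is
  one; otherwise \<open>x\<close> is appended. The second component is the bumped entry.\<close>

fun row_insert :: "nat \<Rightarrow> nat list \<Rightarrow> nat list \<times> nat option" where
  "row_insert x [] = ([x], None)"
| "row_insert x (y # r) =
     (if x < y then (x # r, Some y)
      else (case row_insert x r of (r', b) \<Rightarrow> (y # r', b)))"

text \<open>The second component is the index of the row in which the shape has gained a box.\<close>

fun rs_insert :: "nat \<Rightarrow> tableau \<Rightarrow> tableau \<times> nat" where
  "rs_insert x [] = ([[x]], 0)"
| "rs_insert x (r # T) =
     (case row_insert x r of
        (r', None) \<Rightarrow> (r' # T, 0)
      | (r', Some y) \<Rightarrow> (case rs_insert y T of (T', k) \<Rightarrow> (r' # T', Suc k)))"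

definition append_box :: "nat \<Rightarrow> nat \<Rightarrow> tableau \<Rightarrow> tableau" where
  "append_box m k Q = (if k < length Q then Q[k := Q ! k @ [m]] else Q @ [[m]])"

definition rs_step :: "tableau \<times> tableau \<Rightarrow> nat \<times> nat \<Rightarrow> tableau \<times> tableau" where
  "rs_step = (\<lambda>(P, Q) (x, m). case rs_insert x P of (P', k) \<Rightarrow> (P', append_box m k Q))"

definition robinson_schensted :: "nat list \<Rightarrow> tableau \<times> tableau" where
  "robinson_schensted w = foldl rs_step ([], []) (zip w [1..<Suc (length w)])"

definition recording_tableau :: "nat list \<Rightarrow> tableau" where
  "recording_tableau w = snd (robinson_schensted w)"


section \<open>The box-ball system\<close>

text \<open>In a configuration with \<open>n\<close> balls, \<open>Suc n\<close> stands for an empty box.\<close>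

type_synonym config = "int \<Rightarrow> nat"

definition ball_position :: "config \<Rightarrow> nat \<Rightarrow> int" where
  "ball_position X b = (THE i. X i = b)"

definition jump :: "nat \<Rightarrow> nat \<Rightarrow> config \<Rightarrow> config" where
  "jump n b X =
     (let p = ball_position X b; q = (LEAST q. p < q \<and> X q = Suc n)
      in X(p := Suc n, q := b))"

text \<open>\<^const>\<open>fold\<close> runs through the list from the left, so ball 1 jumps first.\<close>

definition BB :: "nat \<Rightarrow> config \<Rightarrow> config" where
  "BB n X = fold (jump n) [1..<Suc n] X"

definition config_of :: "nat list \<Rightarrow> config" where
  "config_of w = (\<lambda>i. if 1 \<le> i \<and> i \<le> int (length w) then w ! nat (i - 1) else Suc (length w))"

definition increasing_segment :: "nat \<Rightarrow> config \<Rightarrow> int \<Rightarrow> int \<Rightarrow> bool" where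
  "increasing_segment n X a b \<longleftrightarrow>
     a \<le> b \<and> (\<forall>i\<in>{a..b}. X i \<in> {1..n}) \<and> strict_mono_on {a..b} X"

text \<open>A run is identified with its sequence of balls, not with the boxes they occupy: a soliton
  keeps its balls but moves to the right.\<close>

definition increasing_run :: "nat \<Rightarrow> config \<Rightarrow> nat list \<Rightarrow> bool" where
  "increasing_run n X s \<longleftrightarrow>
     (\<exists>a b. increasing_segment n X a b \<and>
        (\<forall>a' b'. a' \<le> a \<and> b \<le> b' \<and> increasing_segment n X a' b' \<longrightarrow> a' = a \<and> b' = b) \<and>
        s = map X [a..b])"

definition soliton :: "nat \<Rightarrow> config \<Rightarrow> nat list \<Rightarrow> bool" where
  "soliton n X s \<longleftrightarrow>
     increasing_run n X s \<and> (\<forall>t. increasing_run n ((BB n ^^ t) X) s)"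

definition steady_state :: "nat \<Rightarrow> config \<Rightarrow> bool" where
  "steady_state n X \<longleftrightarrow> (\<forall>b\<in>{1..n}. \<exists>s. soliton n X s \<and> b \<in> set s)"

text \<open>The infimum is \<open>\<infinity>\<close> if a steady state is never reached; a finite value is the least time.\<close>

definition steady_state_time :: "nat list \<Rightarrow> enat" where
  "steady_state_time w =
     Inf (enat ` {t. steady_state (length w) ((BB (length w) ^^ t) (config_of w))})"

end

theory Submission
  imports Defs
begin

text \<open>
  Both claims rest on looking at a standard tableau through its columns.

  For the equivalence, consider row insertion of the letters of a column, from the largest to the
  smallest, into a tableau made of the columns to its left. Each letter goes to the top of the
  growing column and pushes it down by one row (\<open>rs_insert_add_column\<close>), so that the boxes are added
  from top to bottom, column by column: the recording tableau is column superstandard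
  (\<open>robinson_schensted_columns\<close>). Conversely, bumping paths move weakly to the left. If the new box lies
  at the bottom of the last, shorter column, then the path can never have touched the columns to its
  left, as it would otherwise end further down (\<open>fits_if_box_extends_column\<close>). Hence the letter was
  pushed on top of the last column, and the word is read off the columns of its insertion tableau
  (\<open>columns_of_superstandard_recording\<close>).

  For the box-ball system, the whole evolution is explicit. In the first move every ball below
  the first row of the tableau steps into the box just left by the ball above it in its column,
  while the balls of the first row jump in turn behind the word and form one increasing block
  (\<open>represents_first_move\<close>). From then on the block travels by its own length in each move, and every
  other ball by one box (\<open>represents_later_move\<close>). The ball to the right of a ball outside the block is
  never larger (\<open>no_larger_ball_next\<close>), so in all configurations after the first move the
  increasing runs are the block and the single remaining balls. All of them are solitons, and
  a steady state is reached after one move at the latest.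
\<close>

section \<open>Tableaux as lists of columns\<close>

text \<open>The partition condition and both monotonicity conditions of a tableau are easily stated for its
list of columns \<open>cs\<close>, while row insertion acts on the rows, that is, on the transpose of \<open>cs\<close>.
The following function describes in terms of rows what appending a column does; its last column
may still be shorter than the others, which is the state of a tableau while a column is inserted.\<close>

fun add_column :: "tableau \<Rightarrow> nat list \<Rightarrow> tableau" where
  "add_column T [] = T"
| "add_column [] (x # c) = [x] # add_column [] c"
| "add_column (r # T) (x # c) = (r @ [x]) # add_column T c"

lemma transpose_snoc_Nil: "List.transpose (cs @ [[]]) = List.transpose cs"
proof (induction cs rule: List.transpose.induct)
  case (3 x xs xss)
  then show ?case by simp
qed auto

lemma transpose_snoc:
  assumes "\<forall>d\<in>set cs. length c \<le> length d"
  shows "List.transpose (cs @ [c]) = add_column (List.transpose cs) c"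
  using assms
proof (induction cs arbitrary: c rule: List.transpose.induct)
  case 1
  show ?case by (induction c) auto
next
  case (2 xss)
  then show ?case by (simp add: transpose_snoc_Nil)
next
  case (3 x xs xss)
  show ?case
  proof (cases c)
    case Nil
    then show ?thesis by (simp only: transpose_snoc_Nil add_column.simps)
  next
    case (Cons y ys)
    have "\<forall>d\<in>set (xs # concat (map (case_list [] (\<lambda>h t. [t])) xss)). length ys \<le> length d"
      using 3(2) Cons by (auto split: list.splits)
    then show ?thesis using 3(1)[of ys] Cons by simp
  qed
qed

text \<open>Transposing only rearranges entries, so contents and distinctness can be checked on the columns.\<close>

lemma mset_concat_transpose: "mset (concat (List.transpose xss)) = mset (concat xss)"
proof (induction xss rule: List.transpose.induct)
  case (3 x xs xss)
  have "mset (concat xss) = mset (concat (map (case_list [] (\<lambda>h t. [h])) xss))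
     + mset (concat (concat (map (case_list [] (\<lambda>h t. [t])) xss)))"
    by (induction xss) (auto split: list.splits)
  then show ?case using 3 by simp
qed auto

lemma nth_add_column:
  assumes "length c \<le> length T" "i < length T"
  shows "add_column T c ! i = T ! i @ (if i < length c then [c ! i] else [])"
  using assms
proof (induction T c arbitrary: i rule: add_column.induct)
  case (3 r T x c)
  then show ?case by (cases i) auto
qed auto

lemma length_add_column: "length (add_column T c) = max (length T) (length c)"
  by (induction T c rule: add_column.induct) auto

lemma nth_transpose_full:
  assumes "\<forall>d\<in>set cs. i < length d" "cs \<noteq> []"
  shows "i < length (List.transpose cs)" "List.transpose cs ! i = map (\<lambda>d. d ! i) cs"
proof -
  have "i < foldr (\<lambda>xs. max (length xs)) cs 0"
    using assms by (cases cs) auto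
  then show "i < length (List.transpose cs)" by (simp add: length_transpose)
  then show "List.transpose cs ! i = map (\<lambda>d. d ! i) cs"
    using assms by (subst nth_transpose) (auto simp: filter_True)
qed

definition column_lengths :: "nat list \<Rightarrow> nat list" where
  "column_lengths \<mu> = map (column_length \<mu>) [0..<(if \<mu> = [] then 0 else \<mu> ! 0)]"

lemma integer_partition_column_lengths:
  assumes "integer_partition \<mu>"
  shows "integer_partition (column_lengths \<mu>)"
proof -
  have anti: "column_length \<mu> j' \<le> column_length \<mu> j" if "j \<le> j'" for j j'
    unfolding column_length_def using that by (intro card_mono) auto
  have pos: "column_length \<mu> j > 0" if "\<mu> \<noteq> []" "j < \<mu> ! 0" for j
    unfolding column_length_def using that by (auto simp: card_gt_0_iff)
  show ?thesis
    unfolding integer_partition_def column_lengths_def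
    using pos anti by (auto simp: sorted_wrt_map sorted_wrt_iff_nth_less) (metis neq0_conv)
qed

lemma rev_sorted_lengths:
  "integer_partition (shape T) \<Longrightarrow> sorted (rev (map length T))"
  by (simp add: integer_partition_def shape_def sorted_wrt_rev)

lemma shape_transpose:
  assumes "integer_partition (shape T)"
  shows "shape (List.transpose T) = column_lengths (shape T)"
proof (rule nth_equalityI)
  have *: "length (List.transpose T) = (if shape T = [] then 0 else shape T ! 0)"
    using length_transpose_sorted[OF rev_sorted_lengths[OF assms]] by (simp add: shape_def)
  then show "length (shape (List.transpose T)) = length (column_lengths (shape T))"
    by (simp add: shape_def column_lengths_def)
  fix j assume "j < length (shape (List.transpose T))"
  then have j: "j < length (List.transpose T)" by (simp add: shape_def)
  have "length (List.transpose T ! j) = card {i. i < length T \<and> j < length (T ! i)}"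
    using j by (simp add: nth_transpose length_filter_conv_card)
  also have "\<dots> = column_length (shape T) j"
    unfolding column_length_def by (rule arg_cong[of _ _ card]) (auto simp: shape_def)
  finally show "shape (List.transpose T) ! j = column_lengths (shape T) ! j"
    using j * by (auto simp: shape_def column_lengths_def split: if_splits)
qed

lemma transpose_transpose_partition:
  assumes "integer_partition (shape T)"
  shows "List.transpose (List.transpose T) = T"
proof -
  have "takeWhile (\<lambda>r. r \<noteq> []) T = T"
    using assms by (force simp: takeWhile_eq_all_conv integer_partition_def shape_def)
  then show ?thesis using transpose_transpose[OF rev_sorted_lengths[OF assms]] by simp
qed

text \<open>The last condition ranges over all pairs of columns and not only over adjacent ones, so that it
passes to every sublist; this is the form in which rows of the transpose are seen to increase.\<close>

definition tableau_columns :: "nat list list \<Rightarrow> bool" where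
  "tableau_columns cs \<longleftrightarrow>
     integer_partition (shape cs) \<and> (\<forall>c\<in>set cs. sorted_wrt (<) c) \<and>
     sorted_wrt (\<lambda>c d. \<forall>i<length d. c ! i < d ! i) cs"

lemma tableau_columns_transpose:
  assumes "standard_tableau n T"
  shows "tableau_columns (List.transpose T)"
proof -
  have P: "integer_partition (shape T)" and R: "\<forall>r\<in>set T. sorted_wrt (<) r"
    and C: "\<forall>c\<in>set (List.transpose T). sorted_wrt (<) c"
    using assms by (auto simp: standard_tableau_def)
  have "List.transpose T ! j ! i < List.transpose T ! k ! i"
    if "j < k" "k < length (List.transpose T)" "i < length (List.transpose T ! k)" for i j k
  proof -
    note S = rev_sorted_lengths[OF P]
    have I: "integer_partition (shape (List.transpose T))"
      using P by (simp add: shape_transpose integer_partition_column_lengths)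
    then have "length (List.transpose T ! k) \<le> length (List.transpose T ! j)"
      using that by (auto simp: integer_partition_def shape_def sorted_wrt_map sorted_wrt_iff_nth_less)
    then have ij: "i < length (List.transpose T ! j)" using that by simp
    have ik: "i < length [ys\<leftarrow>T. k < length ys]" and ij': "i < length [ys\<leftarrow>T. j < length ys]"
      using ij that nth_transpose[of k T] nth_transpose[of j T] by auto
    have i: "i < length T" using ik length_filter_le[of "\<lambda>ys. k < length ys" T] by linarith
    have "k < length (T ! i)"
      using ik nth_mem[of i "takeWhile (\<lambda>ys. k < length ys) T"] takeWhile_nth[of i _ T]
      by (auto simp: filter_equals_takeWhile_sorted_rev[OF S] dest: set_takeWhileD)
    then show ?thesis
      using nth_nth_transpose_sorted[OF S _ ik] nth_nth_transpose_sorted[OF S _ ij'] that R i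
      by (auto simp: sorted_wrt_iff_nth_less)
  qed
  then show ?thesis
    using P C by (auto simp: tableau_columns_def shape_transpose integer_partition_column_lengths
        sorted_wrt_iff_nth_less)
qed

lemma standard_tableau_transpose:
  assumes "tableau_columns cs" "distinct (concat cs)" "set (concat cs) = {1..n}"
  shows "standard_tableau n (List.transpose cs)"
proof -
  have P: "integer_partition (shape cs)" using assms by (simp add: tableau_columns_def)
  note m = mset_concat_transpose[of cs]
  have "sorted_wrt (<) (List.transpose cs ! i)" if "i < length (List.transpose cs)" for i
  proof -
    have "sorted_wrt (\<lambda>c d. \<forall>i<length d. c ! i < d ! i) [c\<leftarrow>cs. i < length c]"
      using assms by (simp add: tableau_columns_def sorted_wrt_filter)
    then have "sorted_wrt (\<lambda>c d. c ! i < d ! i) [c\<leftarrow>cs. i < length c]"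
      by (rule sorted_wrt_mono_rel[rotated]) auto
    then show ?thesis using that by (simp add: nth_transpose sorted_wrt_map)
  qed
  then have "\<forall>r\<in>set (List.transpose cs). sorted_wrt (<) r" by (auto simp: in_set_conv_nth)
  then show ?thesis
    using assms mset_eq_setD[OF m] mset_eq_imp_distinct_iff[OF m]
    by (simp add: standard_tableau_def tableau_columns_def transpose_transpose_partition
        shape_transpose integer_partition_column_lengths)
qed

section \<open>Inserting a letter into a growing column\<close>

lemma row_insert_append:
  "\<forall>y\<in>set r. y \<le> x \<Longrightarrow> row_insert x r = (r @ [x], None)"
  by (induction r) auto

lemma row_insert_bump_last:
  "\<forall>y\<in>set r. y \<le> x \<Longrightarrow> x < y \<Longrightarrow> row_insert x (r @ [y]) = (r @ [x], Some y)"
  by (induction r) auto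

lemma row_insert_bump_left:
  "p < length r \<Longrightarrow> x < r ! p \<Longrightarrow> \<exists>q\<le>p. \<exists>r'. row_insert x r = (r', Some (r ! q))"
proof (induction r arbitrary: p)
  case (Cons y r)
  show ?case
  proof (cases "x < y")
    case False
    with Cons.prems obtain p' where "p = Suc p'" "p' < length r" "x < r ! p'"
      by (cases p) auto
    with Cons.IH[of p'] obtain q r' where "q \<le> p'" "row_insert x r = (r', Some (r ! q))" by blast
    then show ?thesis using False \<open>p = Suc p'\<close> by (intro exI[of _ "Suc q"]) auto
  qed auto
qed simp

text \<open>If \<open>x\<close> and the entries of the partial column \<open>c\<close> are large enough to stand next to \<open>T\<close> after all
of \<open>c\<close> has moved down by one row, then in every row nothing of \<open>T\<close> is bumped: \<open>x\<close> bumps the top entry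
of \<open>c\<close>, which bumps the next one, and so on. So the insertion pushes \<open>x\<close> on top of \<open>c\<close>, and the
new box lies below the column.\<close>

lemma rs_insert_add_column:
  assumes "sorted_wrt (<) (x # c)"
    and "T = [] \<or> length c < length T"
    and "\<forall>i\<le>length c. i < length T \<longrightarrow> (\<forall>z\<in>set (T ! i). z \<le> (x # c) ! i)"
  shows "rs_insert x (add_column T c) = (add_column T (x # c), length c)"
  using assms
proof (induction c arbitrary: x T)
  case Nil
  then show ?case by (cases T) (auto simp: row_insert_append)
next
  case (Cons y c)
  show ?case
  proof (cases T)
    case Nil
    then show ?thesis using Cons.prems Cons.IH[of y "[]"] by simp
  next
    case (Cons r T')
    have "\<forall>z\<in>set r. z \<le> x" using Cons.prems(3) Cons by force
    moreover have "rs_insert y (add_column T' c) = (add_column T' (y # c), length c)"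
    proof (rule Cons.IH)
      show "T' = [] \<or> length c < length T'" using Cons.prems(2) Cons by auto
      show "\<forall>i\<le>length c. i < length T' \<longrightarrow> (\<forall>z\<in>set (T' ! i). z \<le> (y # c) ! i)"
      proof (intro allI impI)
        fix i assume "i \<le> length c" "i < length T'"
        then show "\<forall>z\<in>set (T' ! i). z \<le> (y # c) ! i"
          using Cons.prems(3)[rule_format, of "Suc i"] Cons by auto
      qed
    qed (use Cons.prems(1) in auto)
    ultimately show ?thesis using Cons Cons.prems(1) by (simp add: row_insert_bump_last)
  qed
qed

text \<open>Bumping paths move weakly to the left as they go down: the entry bumped in column \<open>p\<close> is smaller
than its neighbour below, so in the next row a bump happens in column \<open>p\<close> or further left, as long
as that row is long enough. A path that starts in a column reaching down to row \<open>k\<close>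
therefore cannot stop within the first \<open>k + 1\<close> rows.\<close>

lemma rs_insert_passes_left_bump:
  assumes "\<forall>i\<le>k. i < length P \<and> p < length (P ! i)"
    and "\<forall>i<k. \<forall>q\<le>p. P ! i ! q < P ! Suc i ! q"
    and "x < P ! 0 ! p"
  shows "k < snd (rs_insert x P)"
  using assms
proof (induction k arbitrary: x P p)
  case 0
  then obtain r T where P: "P = r # T" by (cases P) auto
  with 0 row_insert_bump_left[of p r x] obtain q r' where "row_insert x r = (r', Some (r ! q))"
    by auto
  then show ?case using P by (auto split: prod.splits)
next
  case (Suc k)
  then obtain r T where P: "P = r # T" by (cases P) auto
  with Suc.prems row_insert_bump_left[of p r x]
  obtain q r' where q: "q \<le> p" "row_insert x r = (r', Some (r ! q))" by fastforce
  have "k < snd (rs_insert (r ! q) T)"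
  proof (rule Suc.IH)
    show "\<forall>i\<le>k. i < length T \<and> q < length (T ! i)"
    proof (intro allI impI)
      fix i assume "i \<le> k"
      then show "i < length T \<and> q < length (T ! i)"
        using Suc.prems(1)[rule_format, of "Suc i"] q(1) P by simp
    qed
    show "\<forall>i<k. \<forall>q'\<le>q. T ! i ! q' < T ! Suc i ! q'"
    proof (intro allI impI)
      fix i q' assume "i < k" "q' \<le> q"
      then show "T ! i ! q' < T ! Suc i ! q'"
        using Suc.prems(2)[rule_format, of "Suc i" q'] q(1) P by simp
    qed
    show "r ! q < T ! 0 ! q" using Suc.prems(2)[rule_format, of 0 q] q(1) P by simp
  qed
  then show ?case using P q by (auto split: prod.splits)
qed

text \<open>Conversely, if the new box appears below \<open>c\<close>, then the bumping path runs down \<open>c\<close>: had it bumped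
an entry of \<open>T\<close> in some row, it would have passed the row of the new box, because \<open>T\<close> has full
width \<open>j\<close> there; had it appended to a row above, the box would be too high.\<close>

lemma fits_if_box_extends_column:
  assumes "snd (rs_insert x (add_column T c)) = length c"
    and "T = [] \<or> length c < length T"
    and "\<forall>i\<le>length c. i < length T \<longrightarrow> length (T ! i) = j"
    and "\<forall>i<length c. Suc i < length T \<longrightarrow> (\<forall>q<j. T ! i ! q < T ! Suc i ! q)"
    and "sorted_wrt (<) c"
  shows "sorted_wrt (<) (x # c) \<and>
    (\<forall>i\<le>length c. i < length T \<longrightarrow> (\<forall>z\<in>set (T ! i). z \<le> (x # c) ! i))"
  using assms
proof (induction c arbitrary: x T)
  case Nil
  show ?case
  proof (cases T)
    case (Cons r T')
    have "z \<le> x" if "z \<in> set r" for z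
    proof (rule ccontr)
      assume "\<not> z \<le> x"
      with that obtain p where "p < length r" "x < r ! p" by (auto simp: in_set_conv_nth not_le)
      then have "0 < snd (rs_insert x T)" using Cons by (intro rs_insert_passes_left_bump[of _ _ p]) auto
      then show False using Nil by simp
    qed
    then show ?thesis using Cons by auto
  qed simp
next
  case (Cons y c)
  let ?P = "add_column T (y # c)"
  have first: "z \<le> x" if "T = r # T'" "z \<in> set r" for z r T'
  proof (rule ccontr)
    assume "\<not> z \<le> x"
    with that obtain p where p: "p < length r" "x < r ! p" by (auto simp: in_set_conv_nth not_le)
    have len: "length (y # c) < length T" using Cons.prems(2) that by auto
    have j: "length r = j" using Cons.prems(3)[rule_format, of 0] that by simp
    have nth: "?P ! i ! q = T ! i ! q" "q < length (?P ! i)"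
      if "i \<le> length (y # c)" "q < j" for i q
      using that len Cons.prems(3) nth_add_column[of "y # c" T i] by (auto simp: nth_append)
    have "length (y # c) < snd (rs_insert x ?P)"
    proof (rule rs_insert_passes_left_bump)
      show "\<forall>i\<le>length (y # c). i < length ?P \<and> p < length (?P ! i)"
        using nth(2)[of _ p] len p j by (auto simp: length_add_column)
      show "\<forall>i<length (y # c). \<forall>q\<le>p. ?P ! i ! q < ?P ! Suc i ! q"
        using nth(1) len p j Cons.prems(4) by auto
      show "x < ?P ! 0 ! p" using nth(1)[of 0 p] p j that by simp
    qed
    then show False using Cons.prems(1) by simp
  qed
  define r where "r = (case T of [] \<Rightarrow> [] | r # T' \<Rightarrow> r)"
  define T' where "T' = tl T"
  have P: "?P = (r @ [y]) # add_column T' c" by (cases T) (auto simp: r_def T'_def)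
  have r: "\<forall>z\<in>set r. z \<le> x" using first by (auto simp: r_def split: list.splits)
  have xy: "x < y"
  proof (rule ccontr)
    assume "\<not> x < y"
    then have "row_insert x (r @ [y]) = (r @ [y] @ [x], None)"
      using r by (subst row_insert_append) auto
    then show False using Cons.prems(1) P by simp
  qed
  have IH: "sorted_wrt (<) (y # c) \<and>
    (\<forall>i\<le>length c. i < length T' \<longrightarrow> (\<forall>z\<in>set (T' ! i). z \<le> (y # c) ! i))"
  proof (rule Cons.IH)
    show "snd (rs_insert y (add_column T' c)) = length c"
      using Cons.prems(1) P xy r by (simp add: row_insert_bump_last split: prod.splits)
    show "T' = [] \<or> length c < length T'" using Cons.prems(2) by (auto simp: T'_def)
    show "\<forall>i\<le>length c. i < length T' \<longrightarrow> length (T' ! i) = j"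
      using Cons.prems(3) by (auto simp: T'_def nth_tl)
    show "\<forall>i<length c. Suc i < length T' \<longrightarrow> (\<forall>q<j. T' ! i ! q < T' ! Suc i ! q)"
      using Cons.prems(4) by (auto simp: T'_def nth_tl)
    show "sorted_wrt (<) c" using Cons.prems(5) by simp
  qed
  have "\<forall>z\<in>set (T ! i). z \<le> (x # y # c) ! i" if "i \<le> length (y # c)" "i < length T" for i
  proof (cases i)
    case 0
    then show ?thesis using r that by (cases T) (auto simp: r_def)
  next
    case (Suc i')
    then show ?thesis using IH that by (auto simp: T'_def nth_tl)
  qed
  then show ?case using IH xy by auto
qed

section \<open>The recording tableau of a column reading word\<close>

lemma robinson_schensted_snoc:
  "robinson_schensted (w @ [x]) = rs_step (robinson_schensted w) (x, Suc (length w))"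
proof -
  have "[1..<Suc (Suc (length w))] = [1..<Suc (length w)] @ [Suc (length w)]"
    by (simp add: upt_Suc_append del: upt_Suc)
  then show ?thesis by (simp add: robinson_schensted_def del: upt_Suc)
qed

text \<open>In the recording tableau a column grows at its bottom, whereas in the insertion tableau it grows
at its top; both have the same shape.\<close>

lemma append_box_add_column:
  assumes "T = [] \<or> length c < length T"
  shows "append_box m (length c) (add_column T c) = add_column T (c @ [m])"
  using assms
proof (induction T c rule: add_column.induct)
  case (1 T)
  then show ?case by (cases T) (auto simp: append_box_def)
next
  case (2 x c)
  then show ?case by (auto simp: append_box_def split: if_splits)
next
  case (3 r T x c)
  then show ?case by (cases "T = []") (auto simp: append_box_def split: if_splits)
qed

text \<open>The parameter lists the column heights, not the row lengths, so that the last column or its lowest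
box can be split off by an equation between lists.\<close>

definition superstandard_columns :: "nat list \<Rightarrow> nat list list" where
  "superstandard_columns hs =
     map (\<lambda>j. map (\<lambda>i. (\<Sum>k<j. hs ! k) + i + 1) [0..<hs ! j]) [0..<length hs]"

lemma superstandard_columns_snoc:
  "superstandard_columns (hs @ [h]) =
     superstandard_columns hs @ [map (\<lambda>i. sum_list hs + i + 1) [0..<h]]"
proof -
  have *: "(\<Sum>k<j. (hs @ [h]) ! k) = (\<Sum>k<j. hs ! k)" if "j \<le> length hs" for j
    using that by (intro sum.cong) (auto simp: nth_append)
  show ?thesis unfolding superstandard_columns_def
    by (auto simp: nth_append * sum_list_sum_nth atLeast0LessThan)
qed

lemma shape_superstandard_columns: "shape (superstandard_columns hs) = hs"
  by (simp add: shape_def superstandard_columns_def map_nth comp_def)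

lemma shape_column_superstandard: "shape (column_superstandard \<mu>) = \<mu>"
  by (simp add: shape_def column_superstandard_def map_nth comp_def)

text \<open>The rows longer than \<open>j\<close> come first in a partition, so column \<open>j\<close> occupies an initial segment of rows.\<close>

lemma filter_partition_upt:
  assumes "sorted_wrt (\<ge>) \<mu>"
  shows "[i\<leftarrow>[0..<length \<mu>]. j < \<mu> ! i] = [0..<column_length \<mu> j]"
proof -
  have s: "sorted (rev (map ((!) \<mu>) [0..<length \<mu>]))"
    using assms by (simp add: map_nth sorted_wrt_rev)
  let ?F = "[i\<leftarrow>[0..<length \<mu>]. j < \<mu> ! i]"
  have "length ?F = column_length \<mu> j"
    by (simp add: column_length_def length_filter_conv_card Int_def conj_commute lessThan_def cong: conj_cong)
  moreover have "?F = takeWhile (\<lambda>i. j < \<mu> ! i) [0..<length \<mu>]"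
    by (rule filter_equals_takeWhile_sorted_rev[OF s])
  moreover have "\<dots> = take (length (takeWhile (\<lambda>i. j < \<mu> ! i) [0..<length \<mu>])) [0..<length \<mu>]"
    by (rule takeWhile_eq_take)
  moreover have "length ?F \<le> length \<mu>" using length_filter_le[of _ "[0..<length \<mu>]"] by simp
  ultimately show ?thesis by (metis add_0 take_upt)
qed

lemma column_superstandard_eq:
  assumes "integer_partition \<mu>"
  shows "column_superstandard \<mu> = List.transpose (superstandard_columns (column_lengths \<mu>))"
proof -
  let ?S = "column_superstandard \<mu>"
  have P: "integer_partition (shape ?S)" using assms by (simp add: shape_column_superstandard)
  have sh: "shape (List.transpose ?S) = column_lengths \<mu>"
    using shape_transpose[OF P] by (simp add: shape_column_superstandard)
  have "List.transpose ?S = superstandard_columns (column_lengths \<mu>)"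
  proof (rule nth_equalityI)
    show len: "length (List.transpose ?S) = length (superstandard_columns (column_lengths \<mu>))"
      using arg_cong[OF sh, of length] by (simp add: shape_def superstandard_columns_def)
    fix j assume j: "j < length (List.transpose ?S)"
    then have j': "j < length (column_lengths \<mu>)" using len by (simp add: superstandard_columns_def)
    have nth: "column_lengths \<mu> ! k = column_length \<mu> k" if "k \<le> j" for k
      using j' that by (auto simp: column_lengths_def split: if_splits)
    let ?row = "\<lambda>i. map (\<lambda>j. (\<Sum>k<j. column_length \<mu> k) + i + 1) [0..<\<mu> ! i]"
    have "List.transpose ?S ! j = map (\<lambda>r. r ! j) [r\<leftarrow>?S. j < length r]"
      by (rule nth_transpose[OF j])
    also have "\<dots> = map (\<lambda>i. ?row i ! j) [i\<leftarrow>[0..<length \<mu>]. j < \<mu> ! i]"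
      by (simp add: column_superstandard_def filter_map comp_def)
    also have "\<dots> = map (\<lambda>i. (\<Sum>k<j. column_length \<mu> k) + i + 1) [i\<leftarrow>[0..<length \<mu>]. j < \<mu> ! i]"
      by (rule map_cong) auto
    also have "\<dots> = map (\<lambda>i. (\<Sum>k<j. column_length \<mu> k) + i + 1) [0..<column_length \<mu> j]"
      using assms by (simp add: filter_partition_upt integer_partition_def)
    also have "\<dots> = superstandard_columns (column_lengths \<mu>) ! j"
      using j' nth by (simp add: superstandard_columns_def)
    finally show "List.transpose ?S ! j = superstandard_columns (column_lengths \<mu>) ! j" .
  qed
  then show ?thesis using transpose_transpose_partition[OF P] by simp
qed

lemma length_transpose_cong:
  assumes "shape A = shape B"
  shows "length (List.transpose A) = length (List.transpose B)"
proof -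
  have "foldr (\<lambda>r. max (length r)) C 0 = foldr max (shape C) 0" for C :: tableau
    by (simp add: shape_def foldr_map comp_def)
  then show ?thesis by (simp add: length_transpose assms)
qed

lemma superstandard_columns_lengths:
  "(\<forall>c\<in>set (superstandard_columns hs). P (length c)) \<longleftrightarrow> (\<forall>h\<in>set hs. P h)"
proof -
  have "(\<forall>h\<in>set (shape (superstandard_columns hs)). P h) \<longleftrightarrow>
      (\<forall>c\<in>set (superstandard_columns hs). P (length c))"
    by (simp add: shape_def)
  then show ?thesis by (simp add: shape_superstandard_columns)
qed

lemma integer_partition_snoc:
  "integer_partition (hs @ [h]) \<longleftrightarrow> integer_partition hs \<and> 0 < h \<and> (\<forall>k\<in>set hs. h \<le> k)"
  by (auto simp: integer_partition_def sorted_wrt_append)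

lemma tableau_columns_snoc:
  "tableau_columns (cs @ [c]) \<longleftrightarrow>
     tableau_columns cs \<and> c \<noteq> [] \<and> sorted_wrt (<) c \<and>
     (\<forall>d\<in>set cs. length c \<le> length d \<and> (\<forall>i<length c. d ! i < c ! i))"
  using integer_partition_snoc[of "shape cs" "length c"]
  by (auto simp: tableau_columns_def shape_def sorted_wrt_append)

lemma rs_step_add_column:
  assumes "sorted_wrt (<) (x # c)" "T = [] \<or> length c < length T"
    and "\<forall>i\<le>length c. i < length T \<longrightarrow> (\<forall>z\<in>set (T ! i). z \<le> (x # c) ! i)"
    and "length S = length T" "length d = length c"
  shows "rs_step (add_column T c, add_column S d) (x, m) =
    (add_column T (x # c), add_column S (d @ [m]))"
proof -
  have "S = [] \<or> length d < length S" using assms by auto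
  from append_box_add_column[OF this, of m] show ?thesis
    using rs_insert_add_column[OF assms(1-3)] assms(5) by (simp add: rs_step_def)
qed

text \<open>Each column is read from its largest entry to its smallest one. After \<open>k\<close> letters of the column \<open>C\<close>,
the insertion tableau consists of the previous columns and of the last \<open>k\<close> entries of \<open>C\<close>, moved up to
the first row. Moving up keeps the rows increasing, since it only replaces entries of \<open>C\<close> by larger
ones.\<close>

theorem robinson_schensted_columns:
  assumes "tableau_columns cs"
  shows "robinson_schensted (concat (map rev cs)) =
    (List.transpose cs, List.transpose (superstandard_columns (shape cs)))"
  using assms
proof (induction cs rule: rev_induct)
  case Nil
  then show ?case by (simp add: robinson_schensted_def superstandard_columns_def shape_def)
next
  case (snoc C cs)
  then have C: "C \<noteq> []" "sorted_wrt (<) C"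
    and cs: "\<And>d. d \<in> set cs \<Longrightarrow> length C \<le> length d"
      "\<And>d i. d \<in> set cs \<Longrightarrow> i < length C \<Longrightarrow> d ! i < C ! i"
    by (auto simp: tableau_columns_snoc)
  let ?w = "concat (map rev cs)"
  define T where "T = List.transpose cs"
  define S where "S = List.transpose (superstandard_columns (shape cs))"
  have len: "length ?w = sum_list (shape cs)" by (simp add: length_concat shape_def comp_def)
  have IH: "robinson_schensted ?w = (T, S)" using snoc by (simp add: tableau_columns_snoc T_def S_def)
  have ST: "length S = length T"
    unfolding S_def T_def by (rule length_transpose_cong) (simp add: shape_superstandard_columns)
  have "robinson_schensted (?w @ take k (rev C)) =
    (add_column T (drop (length C - k) C),
     add_column S (map (\<lambda>i. sum_list (shape cs) + i + 1) [0..<k]))" if "k \<le> length C" for k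
    using that
  proof (induction k)
    case 0
    then show ?case using IH by simp
  next
    case (Suc k)
    define l where "l = length C - Suc k"
    define c where "c = drop (Suc l) C"
    have l: "l < length C" "length C - k = Suc l" "length c = k"
      using Suc.prems by (auto simp: l_def c_def)
    have x: "drop l C = C ! l # c" unfolding c_def using l by (simp add: Cons_nth_drop_Suc)
    have "take (Suc k) (rev C) = take k (rev C) @ [C ! l]"
      using Suc.prems by (simp add: take_Suc_conv_app_nth rev_nth l_def)
    then have "robinson_schensted (?w @ take (Suc k) (rev C)) =
      rs_step (robinson_schensted (?w @ take k (rev C))) (C ! l, Suc (length (?w @ take k (rev C))))"
      using robinson_schensted_snoc[of "?w @ take k (rev C)" "C ! l"] by simp
    also have "\<dots> = rs_step (add_column T c, add_column S (map (\<lambda>i. sum_list (shape cs) + i + 1) [0..<k]))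
        (C ! l, sum_list (shape cs) + k + 1)"
      using Suc l len by (simp add: c_def)
    also have "\<dots> = (add_column T (C ! l # c),
      add_column S (map (\<lambda>i. sum_list (shape cs) + i + 1) [0..<k] @ [sum_list (shape cs) + k + 1]))"
    proof (rule rs_step_add_column)
      show "sorted_wrt (<) (C ! l # c)" using C(2) x by (metis sorted_wrt_drop)
      show "T = [] \<or> length c < length T"
      proof (cases "cs = []")
        case False
        then show ?thesis using nth_transpose_full(1)[of cs k] cs(1) Suc.prems l
          by (fastforce simp: T_def)
      qed (simp add: T_def)
      show "\<forall>i\<le>length c. i < length T \<longrightarrow> (\<forall>z\<in>set (T ! i). z \<le> (C ! l # c) ! i)"
      proof (intro allI impI ballI)
        fix i z assume i: "i \<le> length c" "i < length T" and z: "z \<in> set (T ! i)"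
        have li: "l + i < length C" using i l Suc.prems by (simp add: l_def)
        obtain d where d: "d \<in> set cs" "z = d ! i"
          using i z by (auto simp: T_def nth_transpose)
        have "z < C ! i" using cs(2) d li by simp
        also have "C ! i \<le> C ! (l + i)"
          using C(2) li by (cases "l = 0") (auto simp: sorted_wrt_iff_nth_less less_imp_le)
        also have "C ! (l + i) = (C ! l # c) ! i" using x[symmetric] li by simp
        finally show "z \<le> (C ! l # c) ! i" by simp
      qed
    qed (use ST l in simp_all)
    finally show ?case using x by (simp add: l_def)
  qed
  from this[of "length C"]
  have "robinson_schensted (?w @ rev C) =
    (add_column T C, add_column S (map (\<lambda>i. sum_list (shape cs) + i + 1) [0..<length C]))"
    by simp
  moreover have "List.transpose (cs @ [C]) = add_column T C"
    using cs(1) by (simp add: T_def transpose_snoc)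
  moreover have "List.transpose (superstandard_columns (shape (cs @ [C]))) =
    add_column S (map (\<lambda>i. sum_list (shape cs) + i + 1) [0..<length C])"
  proof -
    have "\<forall>d\<in>set (superstandard_columns (shape cs)). length C \<le> length d"
      using cs(1) by (simp add: superstandard_columns_lengths) (simp add: shape_def)
    moreover have "shape (cs @ [C]) = shape cs @ [length C]" by (simp add: shape_def)
    ultimately show ?thesis by (simp add: S_def superstandard_columns_snoc transpose_snoc)
  qed
  ultimately show ?case by simp
qed

lemma length_rs_insert:
  "k = snd (rs_insert x P) \<Longrightarrow>
     k \<le> length P \<and> length (fst (rs_insert x P)) = max (length P) (Suc k)"
proof (induction x P arbitrary: k rule: rs_insert.induct)
  case (2 x r T)
  then show ?case by (fastforce split: prod.splits option.splits)
qed simp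

lemma append_box_entries:
  assumes "k \<le> length Q"
  shows "mset (concat (append_box m k Q)) = add_mset m (mset (concat Q))"
proof (cases "k < length Q")
  case True
  then have "mset (concat Q) = mset (concat (take k Q @ Q ! k # drop (Suc k) Q))"
    by (simp only: id_take_nth_drop[symmetric])
  then show ?thesis using True by (simp add: append_box_def upd_conv_take_nth_drop)
qed (simp add: append_box_def)

lemma append_box_rows:
  assumes "k \<le> length Q" "[] \<notin> set Q"
  shows "length (append_box m k Q) = max (length Q) (Suc k)" "[] \<notin> set (append_box m k Q)"
  using assms set_update_subset_insert[of Q k "Q ! k @ [m]"] by (auto simp: append_box_def)

lemma recording_tableau_invariant:
  "length (fst (robinson_schensted w)) = length (recording_tableau w) \<and>
   [] \<notin> set (recording_tableau w) \<and>
   mset (concat (recording_tableau w)) = mset [1..<Suc (length w)]"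
proof (induction w rule: rev_induct)
  case Nil
  then show ?case by (simp add: robinson_schensted_def recording_tableau_def)
next
  case (snoc x w)
  obtain P Q where PQ: "robinson_schensted w = (P, Q)" by fastforce
  obtain P' k where k: "rs_insert x P = (P', k)" by fastforce
  have "k \<le> length P" "length P' = max (length P) (Suc k)"
    using length_rs_insert[of k x P] k by auto
  then show ?case
    using snoc PQ k append_box_rows[of k Q] append_box_entries[of k Q]
    by (simp add: robinson_schensted_snoc rs_step_def recording_tableau_def)
qed

text \<open>The new entry \<open>m\<close> can be deleted again; since no row is empty, the row that
consisted of \<open>m\<close> alone is recognised and disappears.\<close>

lemma append_box_inject:
  assumes "append_box m k Q = append_box m k' Q'"
    and "k \<le> length Q" "\<forall>r\<in>set Q. m \<notin> set r" "[] \<notin> set Q"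
    and "k' \<le> length Q'" "\<forall>r\<in>set Q'. m \<notin> set r" "[] \<notin> set Q'"
  shows "k = k' \<and> Q = Q'"
proof -
  define R where "R = (\<lambda>Q. filter (\<lambda>r. r \<noteq> []) (map (filter (\<lambda>x. x \<noteq> m)) Q))"
  have R: "R (append_box m k Q) = Q"
    if "k \<le> length Q" "\<forall>r\<in>set Q. m \<notin> set r" "[] \<notin> set Q" for k Q
  proof -
    have *: "filter (\<lambda>x. x \<noteq> m) r = r" if "r \<in> set Q" for r
      using that \<open>\<forall>r\<in>set Q. m \<notin> set r\<close> by (auto simp: filter_id_conv)
    have m: "map (filter (\<lambda>x. x \<noteq> m)) Q = Q" using * by (simp add: map_idI)
    have f: "filter (\<lambda>r. r \<noteq> []) Q = Q" using that by (auto simp: filter_id_conv)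
    show ?thesis
    proof (cases "k < length Q")
      case True
      then have "Q[k := Q ! k] = Q" by simp
      then show ?thesis using True m f *[of "Q ! k"] by (simp add: R_def append_box_def map_update)
    qed (use m f in \<open>simp add: R_def append_box_def\<close>)
  qed
  have Q: "Q = Q'" using R[of k Q] R[of k' Q'] assms by simp
  have mem: "m \<in> set (append_box m i Q ! j) \<longleftrightarrow> j = i"
    if "i \<le> length Q" "j < length (append_box m i Q)" for i j
    using that assms(3) by (auto simp: append_box_def nth_append nth_list_update less_Suc_eq split: if_splits)
  have "k < length (append_box m k Q)" using assms(2) by (auto simp: append_box_def)
  then show ?thesis using mem[of k k] mem[of k' k] assms(1,2,5) Q by auto
qed

lemma superstandard_rows:
  assumes "integer_partition hs"
  shows "\<forall>r\<in>set (List.transpose (superstandard_columns hs)). \<forall>m\<in>set r. m \<le> sum_list hs"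
    and "[] \<notin> set (List.transpose (superstandard_columns hs))"
proof -
  have "\<forall>c\<in>set (superstandard_columns hs). \<forall>m\<in>set c. m \<le> sum_list hs"
  proof (induction hs rule: rev_induct)
    case (snoc h hs)
    then show ?case by (auto simp: superstandard_columns_snoc intro: trans_le_add1)
  qed (simp add: superstandard_columns_def)
  then show "\<forall>r\<in>set (List.transpose (superstandard_columns hs)). \<forall>m\<in>set r. m \<le> sum_list hs"
    using mset_eq_setD[OF mset_concat_transpose[of "superstandard_columns hs"]] by fastforce
  have "integer_partition (shape (List.transpose (superstandard_columns hs)))"
    using assms by (simp add: shape_transpose shape_superstandard_columns integer_partition_column_lengths)
  then show "[] \<notin> set (List.transpose (superstandard_columns hs))"
    by (force simp: integer_partition_def shape_def)
qed

text \<open>The letters of \<open>w\<close> are peeled off from the right. The last box of the superstandard tableau lies at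
the bottom of its last column, so the recording tableau without it is again superstandard, and by
induction the shorter word is the reading word of columns \<open>cs0\<close> followed by a partial column \<open>c\<close>. The
position of the last box forces the last letter on top of \<open>c\<close>. Distinctness turns the weak inequalities
between neighbouring columns into strict ones.\<close>

theorem columns_of_superstandard_recording:
  assumes "distinct w"
    and "recording_tableau w = List.transpose (superstandard_columns hs)"
    and "integer_partition hs" "sum_list hs = length w"
  shows "\<exists>cs. shape cs = hs \<and> tableau_columns cs \<and> w = concat (map rev cs)"
  using assms
proof (induction w arbitrary: hs rule: rev_induct)
  case Nil
  then have "hs = []" by (cases hs) (auto simp: integer_partition_def)
  then show ?case
    by (intro exI[of _ "[]"]) (simp add: tableau_columns_def shape_def integer_partition_def)
next
  case (snoc x w)
  obtain hs0 h where hs: "hs = hs0 @ [Suc h]"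
  proof (cases hs rule: rev_cases)
    case (snoc hs0 k)
    then show thesis using that snoc.prems(3) by (cases k) (auto simp: integer_partition_snoc)
  qed (use snoc.prems in simp)
  have p0: "integer_partition hs0" and le: "\<forall>k\<in>set hs0. Suc h \<le> k"
    using snoc.prems(3) hs by (auto simp: integer_partition_snoc)
  \<comment> \<open>A partial column of height 0 is no column: it has to vanish from the list of heights.\<close>
  define hs' where "hs' = (if h = 0 then hs0 else hs0 @ [h])"
  define S where "S = List.transpose (superstandard_columns hs0)"
  define d where "d = map (\<lambda>i. sum_list hs0 + i + 1) [0..<h]"
  have p': "integer_partition hs'" using p0 le by (auto simp: hs'_def integer_partition_snoc)
  have sum': "sum_list hs' = length w" using snoc.prems(4) hs by (auto simp: hs'_def)
  let ?m = "Suc (length w)"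
  have cols: "\<forall>c\<in>set (superstandard_columns hs0). Suc h \<le> length c"
    using le by (simp add: superstandard_columns_lengths)
  have S': "List.transpose (superstandard_columns hs') = add_column S d"
    using cols by (auto simp: hs'_def S_def d_def superstandard_columns_snoc intro!: transpose_snoc)
  have "recording_tableau (w @ [x]) = add_column S (d @ [?m])"
    using snoc.prems(2,4) cols
    by (simp add: hs S_def d_def superstandard_columns_snoc transpose_snoc)
  also have "\<dots> = append_box ?m h (add_column S d)"
  proof -
    have "S = [] \<or> length d < length S"
    proof (cases "superstandard_columns hs0 = []")
      case False
      then show ?thesis using nth_transpose_full(1)[of "superstandard_columns hs0" h] cols
        by (simp add: S_def d_def Suc_le_eq)
    qed (simp add: S_def)
    from append_box_add_column[OF this, of ?m] show ?thesis by (simp add: d_def)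
  qed
  finally have Q1: "recording_tableau (w @ [x]) = append_box ?m h (add_column S d)" .
  obtain P k where P: "P = fst (robinson_schensted w)" and k: "k = snd (rs_insert x P)" by simp
  have "recording_tableau (w @ [x]) = append_box ?m k (recording_tableau w)"
    using P k by (simp add: recording_tableau_def robinson_schensted_snoc rs_step_def split: prod.splits)
  then have eq: "append_box ?m k (recording_tableau w) = append_box ?m h (add_column S d)"
    using Q1 by simp
  have kh: "k = h \<and> recording_tableau w = add_column S d"
  proof (rule append_box_inject[OF eq])
    show "k \<le> length (recording_tableau w)"
      using length_rs_insert[OF k] recording_tableau_invariant[of w] P by simp
    show "\<forall>r\<in>set (recording_tableau w). ?m \<notin> set r"
      using mset_eq_setD[of "concat (recording_tableau w)" "[1..<Suc (length w)]"]
        recording_tableau_invariant[of w] by (auto simp del: upt_Suc)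
    show "[] \<notin> set (recording_tableau w)" using recording_tableau_invariant[of w] by simp
    show "h \<le> length (add_column S d)" by (simp add: length_add_column d_def)
    show "\<forall>r\<in>set (add_column S d). ?m \<notin> set r"
      using superstandard_rows(1)[OF p'] sum' S' by fastforce
    show "[] \<notin> set (add_column S d)" using superstandard_rows(2)[OF p'] S' by simp
  qed
  obtain cs where cs: "shape cs = hs'" "tableau_columns cs" "w = concat (map rev cs)"
    using snoc.IH[of hs'] snoc.prems(1) kh S' p' sum' by auto
  obtain cs0 c where c: "shape cs0 = hs0" "length c = h" "tableau_columns cs0" "sorted_wrt (<) c"
    "List.transpose cs = add_column (List.transpose cs0) c" "concat (map rev cs) = concat (map rev cs0) @ rev c"
  proof (cases "h = 0")
    case True
    then show thesis using cs by (intro that[of cs "[]"]) (auto simp: hs'_def)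
  next
    case False
    then obtain cs0 c where cc: "cs = cs0 @ [c]" "shape cs0 = hs0" "length c = h"
      using cs(1) by (auto simp: hs'_def shape_def map_eq_append_conv)
    then show thesis using cs(2)
      by (intro that[of cs0 c]) (auto simp: tableau_columns_snoc transpose_snoc)
  qed
  define T where "T = List.transpose cs0"
  have len: "Suc (length c) \<le> length e" if "e \<in> set cs0" for e
    using le c(1,2) that by (auto simp: shape_def)
  have T: "i < length T" "T ! i = map (\<lambda>e. e ! i) cs0" if "i \<le> length c" "cs0 \<noteq> []" for i
    using nth_transpose_full[of cs0 i] that len by (fastforce simp: T_def)+
  have RS: "robinson_schensted w = (add_column T c, List.transpose (superstandard_columns hs'))"
    using robinson_schensted_columns[OF cs(2)] cs c by (simp add: T_def)
  have T_Nil: "T = []" if "cs0 = []" using that by (simp add: T_def)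
  have fit: "sorted_wrt (<) (x # c) \<and>
    (\<forall>i\<le>length c. i < length T \<longrightarrow> (\<forall>z\<in>set (T ! i). z \<le> (x # c) ! i))"
  proof (rule fits_if_box_extends_column)
    show "snd (rs_insert x (add_column T c)) = length c" using k kh RS P c(2) by simp
    show "T = [] \<or> length c < length T" using T(1)[of "length c"] T_Nil by auto
    show "\<forall>i\<le>length c. i < length T \<longrightarrow> length (T ! i) = length cs0"
      using T T_Nil by fastforce
    show "\<forall>i<length c. Suc i < length T \<longrightarrow> (\<forall>q<length cs0. T ! i ! q < T ! Suc i ! q)"
    proof (intro allI impI)
      fix i q assume iq: "i < length c" "q < length cs0"
      then have "sorted_wrt (<) (cs0 ! q)" using c(3) by (simp add: tableau_columns_def)
      moreover have "cs0 \<noteq> []" using iq by auto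
      ultimately show "T ! i ! q < T ! Suc i ! q"
        using iq len[of "cs0 ! q"] T(2)[of i] T(2)[of "Suc i"]
        by (simp add: sorted_wrt_iff_nth_less)
    qed
  qed (rule c(4))
  have "e ! i < (x # c) ! i" if "e \<in> set cs0" "i \<le> length c" for e i
  proof -
    have "cs0 \<noteq> []" using that by auto
    then have "e ! i \<le> (x # c) ! i" using fit T[of i] that by auto
    moreover have "e ! i \<noteq> (x # c) ! i"
    proof -
      have "e ! i \<in> set e" using len[of e] that by simp
      then have "e ! i \<in> set (concat (map rev cs0))" using that by auto
      moreover have "(x # c) ! i \<in> set (x # c)" using that nth_mem[of i "x # c"] by simp
      ultimately show ?thesis using snoc.prems(1) cs(3) c(6) by auto
    qed
    ultimately show ?thesis by simp
  qed
  then have "tableau_columns (cs0 @ [x # c])"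
    using c(3) fit len by (auto simp: tableau_columns_snoc less_Suc_eq_le)
  then show ?case
    using c cs hs by (intro exI[of _ "cs0 @ [x # c]"]) (auto simp: shape_def)
qed

theorem column_reading_word_iff_recording_tableau:
  assumes "w \<in> permutations_of_set {1..n}"
  shows "(\<exists>T. standard_tableau n T \<and> w = column_reading_word T) \<longleftrightarrow>
    (\<exists>\<mu>. integer_partition \<mu> \<and> recording_tableau w = column_superstandard \<mu>)"
proof
  assume "\<exists>T. standard_tableau n T \<and> w = column_reading_word T"
  then obtain T where T: "standard_tableau n T" "w = column_reading_word T" by blast
  then have P: "integer_partition (shape T)" by (simp add: standard_tableau_def)
  then have "recording_tableau w = column_superstandard (shape T)"
    using robinson_schensted_columns[OF tableau_columns_transpose[OF T(1)]] T(2)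
    by (simp add: recording_tableau_def column_reading_word_def shape_transpose column_superstandard_eq)
  then show "\<exists>\<mu>. integer_partition \<mu> \<and> recording_tableau w = column_superstandard \<mu>"
    using P by blast
next
  assume "\<exists>\<mu>. integer_partition \<mu> \<and> recording_tableau w = column_superstandard \<mu>"
  then obtain \<mu> where \<mu>: "integer_partition \<mu>"
    "recording_tableau w = List.transpose (superstandard_columns (column_lengths \<mu>))"
    by (auto simp: column_superstandard_eq)
  have w: "distinct w" "set w = {1..n}" using assms by (auto simp: permutations_of_set_def)
  have "sum_list (column_lengths \<mu>) = length w"
  proof -
    let ?S = "superstandard_columns (column_lengths \<mu>)"
    have "length (concat ?S) = sum_list (shape ?S)" by (simp add: length_concat shape_def)
    moreover have "length (concat (List.transpose ?S)) = length (concat ?S)"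
      by (rule mset_eq_length[OF mset_concat_transpose])
    moreover have "length (concat (recording_tableau w)) = length w"
      using recording_tableau_invariant[of w]
        mset_eq_length[of "concat (recording_tableau w)" "[1..<Suc (length w)]"]
      by (simp del: upt_Suc)
    ultimately show ?thesis using \<mu>(2) by (simp add: shape_superstandard_columns)
  qed
  then obtain cs where cs: "tableau_columns cs" "w = concat (map rev cs)"
    using columns_of_superstandard_recording[OF w(1) \<mu>(2)] \<mu>(1)
    by (auto simp: integer_partition_column_lengths)
  have m: "mset (concat cs) = mset w" unfolding cs(2) by (induction cs) auto
  have "standard_tableau n (List.transpose cs)"
    using standard_tableau_transpose[OF cs(1)] w mset_eq_setD[OF m] mset_eq_imp_distinct_iff[OF m] by simp
  moreover have "List.transpose (List.transpose cs) = cs"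
    using cs(1) by (simp add: transpose_transpose_partition tableau_columns_def)
  ultimately show "\<exists>T. standard_tableau n T \<and> w = column_reading_word T"
    using cs(2) by (auto simp: column_reading_word_def)
qed

section \<open>Box-ball moves of labelled positions\<close>

text \<open>A configuration is described by an index set \<open>D\<close> for the balls: the index \<open>d\<close> stands for the ball
\<open>L d\<close>, which lies in box \<open>p d\<close>. This keeps positions separate from labels, so that a ball can be
named by its cell in the tableau.\<close>

definition represents :: "nat \<Rightarrow> 'a set \<Rightarrow> ('a \<Rightarrow> nat) \<Rightarrow> ('a \<Rightarrow> int) \<Rightarrow> config \<Rightarrow> bool" where
  "represents n D L p X \<longleftrightarrow> (\<forall>d\<in>D. X (p d) = L d) \<and> (\<forall>q. q \<notin> p ` D \<longrightarrow> X q = Suc n)"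

lemma represents_jump:
  assumes L: "bij_betw L D {1..n}" and X: "represents n D L p X" and d: "d \<in> D"
    and target: "p d < q" "\<forall>e\<in>D. p e \<noteq> q" "\<forall>r. p d < r \<and> r < q \<longrightarrow> r \<in> p ` D"
  shows "represents n D L (p(d := q)) (jump n (L d) X)"
proof -
  have label: "L e \<noteq> Suc n" if "e \<in> D" for e
    using bij_betwE[OF L] that by fastforce
  have inj: "e = e'" if "e \<in> D" "e' \<in> D" "L e = L e'" for e e'
    using L that by (auto simp: bij_betw_def inj_on_def)
  have at: "X (p e) = L e" if "e \<in> D" for e using X that by (simp add: represents_def)
  have empty: "X r = Suc n" if "r \<notin> p ` D" for r using X that by (simp add: represents_def)
  have "ball_position X (L d) = p d"
    unfolding ball_position_def
  proof (rule the_equality)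
    fix r assume r: "X r = L d"
    then obtain e where "e \<in> D" "r = p e" using empty label d by fastforce
    then show "r = p d" using at r inj d by fastforce
  qed (rule at[OF d])
  moreover have "(LEAST r. p d < r \<and> X r = Suc n) = q"
  proof (rule Least_equality)
    show "p d < q \<and> X q = Suc n" using target(1,2) empty[of q] by auto
    fix r assume r: "p d < r \<and> X r = Suc n"
    then have "r \<notin> p ` D" using at label by fastforce
    then show "q \<le> r" using r target(3) by force
  qed
  ultimately have J: "jump n (L d) X = X(p d := Suc n, q := L d)" by (simp add: jump_def Let_def)
  have sep: "p e \<noteq> p d" if "e \<in> D" "e \<noteq> d" for e using at d that inj by metis
  show ?thesis unfolding represents_def J
  proof (intro conjI ballI allI impI)
    fix e assume "e \<in> D"
    then show "(X(p d := Suc n, q := L d)) ((p(d := q)) e) = L e"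
      using at sep target(2) by auto
  next
    fix r assume r: "r \<notin> p(d := q) ` D"
    have "r \<noteq> q" using r d by auto
    moreover have "r \<notin> p ` D" if "r \<noteq> p d" using r that by force
    ultimately show "(X(p d := Suc n, q := L d)) r = Suc n" using empty by auto
  qed
qed

text \<open>A move from \<open>p\<close> to \<open>p'\<close> can be certified ball by ball, without running the process: when
the ball of \<open>d\<close> jumps, the smaller balls are already at \<open>p'\<close> and the others are still at \<open>p\<close>.\<close>

lemma represents_BB:
  assumes L: "bij_betw L D {1..n}" and X: "represents n D L p X"
    and right: "\<And>d. d \<in> D \<Longrightarrow> p d < p' d"
    and inj: "inj_on p' D"
    and free: "\<And>d e. d \<in> D \<Longrightarrow> e \<in> D \<Longrightarrow> L d \<le> L e \<Longrightarrow> p e \<noteq> p' d"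
    and nearest: "\<And>d q. d \<in> D \<Longrightarrow> p d < q \<Longrightarrow> q < p' d \<Longrightarrow>
      (\<exists>e\<in>D. L e < L d \<and> p' e = q) \<or> (\<exists>e\<in>D. L d < L e \<and> p e = q)"
  shows "represents n D L p' (BB n X)"
proof -
  \<comment> \<open>the positions after the balls up to \<open>k\<close> have jumped\<close>
  define mid where "mid = (\<lambda>k d. if L d \<le> k then p' d else p d)"
  have "represents n D L (mid k) (fold (jump n) [1..<Suc k] X)" if "k \<le> n" for k
    using that
  proof (induction k)
    case 0
    have "mid 0 d = p d" if "d \<in> D" for d
      using bij_betwE[OF L] that by (fastforce simp: mid_def)
    then have "\<forall>d\<in>D. mid 0 d = p d" by blast
    moreover from this have "mid 0 ` D = p ` D" by (intro image_cong) auto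
    ultimately show ?case using X by (simp add: represents_def)
  next
    case (Suc k)
    then obtain d where d: "d \<in> D" "L d = Suc k"
      using bij_betw_imp_surj_on[OF L] by (metis atLeastAtMost_iff imageE le_add1 plus_1_eq_Suc)
    have "represents n D L ((mid k)(d := p' d)) (jump n (L d) (fold (jump n) [1..<Suc k] X))"
    proof (rule represents_jump[OF L _ d(1)])
      show "represents n D L (mid k) (fold (jump n) [1..<Suc k] X)" using Suc by simp
      show "mid k d < p' d" using right d by (simp add: mid_def)
      show "\<forall>e\<in>D. mid k e \<noteq> p' d"
      proof
        fix e assume e: "e \<in> D"
        show "mid k e \<noteq> p' d"
        proof (cases "L e \<le> k")
          case True
          then have "e \<noteq> d" using d by auto
          then show ?thesis using True inj e d by (auto simp: mid_def inj_on_def)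
        qed (use free[OF d(1) e] d in \<open>simp add: mid_def\<close>)
      qed
      show "\<forall>r. mid k d < r \<and> r < p' d \<longrightarrow> r \<in> mid k ` D"
      proof (intro allI impI)
        fix r assume "mid k d < r \<and> r < p' d"
        then have "(\<exists>e\<in>D. L e < L d \<and> p' e = r) \<or> (\<exists>e\<in>D. L d < L e \<and> p e = r)"
          using nearest[OF d(1)] d by (simp add: mid_def)
        then obtain e where "e \<in> D" "mid k e = r" using d by (auto simp: mid_def less_Suc_eq_le)
        then show "r \<in> mid k ` D" by blast
      qed
    qed
    moreover have "((mid k)(d := p' d)) e = mid (Suc k) e" if "e \<in> D" for e
      using that d L by (auto simp: mid_def le_Suc_eq bij_betw_def inj_on_def)
    then have "\<forall>e\<in>D. ((mid k)(d := p' d)) e = mid (Suc k) e" by blast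
    then have "represents n D L ((mid k)(d := p' d)) = represents n D L (mid (Suc k))"
      unfolding represents_def fun_eq_iff by (metis (no_types, lifting) image_cong)
    ultimately show ?case using d by (simp add: upt_Suc_append)
  qed
  then have "represents n D L (mid n) (BB n X)" by (simp add: BB_def)
  moreover have "\<forall>d\<in>D. mid n d = p' d" using bij_betwE[OF L] by (auto simp: mid_def)
  ultimately show ?thesis unfolding represents_def by (metis (no_types, lifting) image_cong)
qed

section \<open>The trajectories of the balls\<close>

text \<open>Cells are pairs of a row \<open>i\<close> and a column \<open>j\<close>, both counted from 0; column \<open>j\<close> has height \<open>h j\<close>.\<close>

locale column_diagram =
  fixes m :: nat and h :: "nat \<Rightarrow> nat"
  assumes h_pos: "j < m \<Longrightarrow> 0 < h j"
begin

definition cells :: "(nat \<times> nat) set" where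
  "cells = {(i, j). j < m \<and> i < h j}"

definition total :: "nat \<Rightarrow> nat" where
  "total j = (\<Sum>k<j. h k)"

text \<open>In the reading word, column \<open>j\<close> fills the boxes after \<open>total j\<close> up to \<open>total (Suc j)\<close>, from the bottom
of the column to its top.\<close>

definition initial :: "nat \<times> nat \<Rightarrow> int" where
  "initial = (\<lambda>(i, j). int (total (Suc j)) - int i)"

text \<open>The position after \<open>t + 1\<close> moves. The first move assembles the first row behind the word, directly
after box \<open>total m\<close>; from then on the row is a block of \<open>m\<close> balls, which travels \<open>m\<close> boxes
per move. Every other ball travels one box per move from the beginning.\<close>

definition later :: "nat \<Rightarrow> nat \<times> nat \<Rightarrow> int" where
  "later t = (\<lambda>(i, j). if i = 0 then int (total m) + 1 + int j + int t * int m
     else initial (i, j) + int t + 1)"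

lemma total_mono: "j \<le> k \<Longrightarrow> total j \<le> total k"
  unfolding total_def by (intro sum_mono2) auto

lemma initial_bounds:
  "(i, j) \<in> cells \<Longrightarrow> int (total j) < initial (i, j) \<and> initial (i, j) \<le> int (total (Suc j))"
  by (simp add: cells_def initial_def total_def)

lemma initial_le: "d \<in> cells \<Longrightarrow> initial d \<le> int (total m) - int (fst d)"
  using total_mono[of "Suc (snd d)" m] by (auto simp: cells_def initial_def)

lemma initial_less:
  assumes "(i, j) \<in> cells" "(i', j') \<in> cells" "j < j'"
  shows "initial (i, j) < initial (i', j')"
  using initial_bounds[OF assms(1)] initial_bounds[OF assms(2)] total_mono[of "Suc j" j'] assms(3)
  by linarith

lemma initial_inj: "inj_on initial cells"
proof (rule inj_onI, clarify)
  fix i j i' j' assume *: "(i, j) \<in> cells" "(i', j') \<in> cells" "initial (i, j) = initial (i', j')"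
  then have "j = j'" using initial_less[of i j i' j'] initial_less[of i' j' i j]
    by (metis less_irrefl linorder_neqE_nat)
  then show "i = i' \<and> j = j'" using * by (simp add: initial_def)
qed

lemma initial_cover:
  assumes "k \<le> m" "0 < q" "q \<le> int (total k)"
  obtains i j where "(i, j) \<in> cells" "j < k" "initial (i, j) = q"
  using assms
proof (induction k arbitrary: thesis)
  case 0
  then show ?case by (simp add: total_def)
next
  case (Suc k)
  show ?case
  proof (cases "q \<le> int (total k)")
    case True
    then show ?thesis using Suc by (metis Suc_leD less_SucI)
  next
    case False
    define i where "i = nat (int (total (Suc k)) - q)"
    have "int i = int (total (Suc k)) - q" using Suc.prems by (simp add: i_def)
    moreover have "i < h k" using False calculation by (simp add: total_def)
    ultimately show ?thesis using Suc.prems by (intro Suc.prems(1)[of i k]) (auto simp: cells_def initial_def)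
  qed
qed

text \<open>For positive \<open>k\<close>, the box \<open>total k\<close> ends column \<open>k - 1\<close> and held its top entry. Without the first row, columns
are therefore separated by an empty box.\<close>

lemma initial_gap:
  assumes "(i, j) \<in> cells" "0 < i"
  shows "initial (i, j) \<noteq> int (total k)"
proof
  assume *: "initial (i, j) = int (total k)"
  then have "total j < total k" using initial_bounds[OF assms(1)] by simp
  then have "Suc j \<le> k" by (metis not_le not_less_eq_eq total_mono)
  then have "total (Suc j) \<le> total k" by (rule total_mono)
  then show False using * assms(2) by (simp add: initial_def)
qed

lemma later_first_row:
  assumes "d \<in> cells" "0 < fst d" "j < m"
  shows "later t d < later t (0, j)"
proof -
  have "later t d \<le> int (total m) + int t"
    using initial_le[OF assms(1)] assms(2) by (cases d) (auto simp: later_def)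
  moreover have "int t \<le> int t * int m" using assms(3) mult_left_mono[of 1 "int m" "int t"] by simp
  ultimately show ?thesis by (simp add: later_def)
qed

lemma later_inj: "inj_on (later t) cells"
proof (rule inj_onI)
  fix d e assume *: "d \<in> cells" "e \<in> cells" "later t d = later t e"
  have "later t x < later t y" if "x \<in> cells" "y \<in> cells" "0 < fst x" "fst y = 0" for x y
    using later_first_row[of x "snd y" t] that by (cases y) (auto simp: cells_def)
  then have "fst d = 0 \<longleftrightarrow> fst e = 0" using * by (metis less_irrefl neq0_conv)
  then show "d = e"
    using * inj_onD[OF initial_inj, of d e] by (cases d; cases e) (auto simp: later_def)
qed

end

locale column_labelling = column_diagram +
  fixes L :: "nat \<times> nat \<Rightarrow> nat"
  assumes label_bij: "bij_betw L cells {1..total m}"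
    and column_increasing: "j < m \<Longrightarrow> i < i' \<Longrightarrow> i' < h j \<Longrightarrow> L (i, j) < L (i', j)"
    and first_row_increasing: "j < j' \<Longrightarrow> j' < m \<Longrightarrow> L (0, j) < L (0, j')"
begin

lemma first_row_cell: "j < m \<Longrightarrow> (0, j) \<in> cells"
  by (simp add: cells_def h_pos)

lemma first_row_le: "(i, j) \<in> cells \<Longrightarrow> k \<le> j \<Longrightarrow> L (0, k) \<le> L (i, j)"
  using column_increasing[of j 0 i] first_row_increasing[of k j]
  by (cases "i = 0"; cases "k = j") (auto simp: cells_def)

text \<open>When the ball of a cell \<open>(0, j)\<close> jumps, no ball of a later column has moved yet, since all of them are
larger. So all boxes up to \<open>total m\<close> are occupied to its right, as are the boxes taken by the earlier
balls of the first row, and it lands right behind those. Every other ball finds the box to its right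
just vacated by the cell above it.\<close>

lemma represents_first_move:
  assumes "represents (total m) cells L initial X"
  shows "represents (total m) cells L (later 0) (BB (total m) X)"
proof (rule represents_BB[OF label_bij assms _ later_inj])
  fix d assume d: "d \<in> cells"
  obtain i j where ij: "d = (i, j)" by fastforce
  show "initial d < later 0 d" using initial_le[OF d] by (auto simp: ij later_def)
  {
    fix e assume e: "e \<in> cells" "L d \<le> L e"
    show "initial e \<noteq> later 0 d"
    proof (cases "i = 0")
      case True
      then show ?thesis using initial_le[OF e(1)] ij by (auto simp: later_def)
    next
      case False
      then have c: "(i - 1, j) \<in> cells" "L (i - 1, j) < L d" "later 0 d = initial (i - 1, j)"
        using d column_increasing[of j "i - 1" i] ij by (auto simp: cells_def later_def initial_def)
      then have "e \<noteq> (i - 1, j)" using e by auto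
      then show ?thesis using inj_onD[OF initial_inj, of e "(i - 1, j)"] c e by auto
    qed
  }
  fix q assume q: "initial d < q" "q < later 0 d"
  then have i: "i = 0" by (cases "i = 0") (auto simp: ij later_def)
  show "(\<exists>e\<in>cells. L e < L d \<and> later 0 e = q) \<or> (\<exists>e\<in>cells. L d < L e \<and> initial e = q)"
  proof (cases "q \<le> int (total m)")
    case True
    have "0 < q" using initial_bounds[of i j] d q ij by simp
    then obtain i' j' where e: "(i', j') \<in> cells" "initial (i', j') = q"
      using initial_cover[of m q] True by blast
    then have "j < j'"
      using q(1) initial_bounds[of i' j'] total_mono[of "Suc j'" "Suc j"]
      by (cases "j < j'") (auto simp: ij i initial_def)
    then have "L d < L (i', j')"
      using first_row_increasing[of j j'] first_row_le[of i' j' j'] e by (auto simp: ij i cells_def)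
    then show ?thesis using e by blast
  next
    case False
    define k where "k = nat (q - int (total m) - 1)"
    have k: "int k = q - int (total m) - 1" using False by (simp add: k_def)
    then have "k < j" using q by (simp add: ij i later_def)
    then have "(0, k) \<in> cells" "L (0, k) < L d"
      using d first_row_cell[of k] first_row_increasing[of k j] by (auto simp: ij i cells_def)
    moreover have "later 0 (0, k) = q" using k by (simp add: later_def)
    ultimately show ?thesis by blast
  qed
qed

text \<open>This makes both the next move and the shape of the runs work: outside of the first row, a ball
has on its right the smaller ball of the cell above, or an empty box, or the first ball of the
first row, which is the smallest of all.\<close>

lemma no_larger_ball_next:
  assumes d: "d \<in> cells" "0 < fst d" and e: "e \<in> cells" "L d \<le> L e"
  shows "later t e \<noteq> later t d + 1"
proof
  assume *: "later t e = later t d + 1"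
  obtain i j where ij: "d = (i, j)" by fastforce
  obtain i' j' where e': "e = (i', j')" by fastforce
  have jm: "j < m" "i < h j" "j' < m" using d e by (auto simp: cells_def ij e')
  show False
  proof (cases "i' = 0")
    case True
    \<comment> \<open>The block has moved at least as far as any other ball, so at most its first ball can be met.\<close>
    have "int t \<le> int t * int m" using jm mult_left_mono[of 1 "int m" "int t"] by simp
    moreover have "int (total m) + 1 + int j' + int t * int m = initial d + int t + 2"
      using * d True by (simp add: later_def ij e')
    ultimately have "j' = 0" using initial_le[OF d(1)] d(2) by simp
    then have "L e \<le> L (0, j)" using first_row_le[of 0 j 0] first_row_cell jm True e' by simp
    also have "\<dots> < L d" using column_increasing[of j 0 i] d jm ij by simp
    finally show False using e by simp
  next
    case False
    then have eq: "initial e = initial (i - 1, j)"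
      using * d by (auto simp: later_def ij e' initial_def)
    show False
    proof (cases "i = 1")
      case True
      then have "initial e = int (total (Suc j))" using eq by (simp add: initial_def)
      then show False using initial_gap[of i' j' "Suc j"] False e e' by simp
    next
      case i: False
      have c: "(i - 1, j) \<in> cells" using d by (auto simp: cells_def ij)
      then have "e = (i - 1, j)" using inj_onD[OF initial_inj eq] e by simp
      then show False using column_increasing[of j "i - 1" i] d e jm ij by auto
    qed
  qed
qed

text \<open>The balls of the block formed by the first row jump over the rest of the block, one after the
other, and every other ball moves to the neighbouring box, which the previous lemma shows to be
free by then.\<close>

lemma represents_later_move:
  assumes "represents (total m) cells L (later t) X"
  shows "represents (total m) cells L (later (Suc t)) (BB (total m) X)"
proof (rule represents_BB[OF label_bij assms _ later_inj])
  fix d assume d: "d \<in> cells"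
  obtain i j where ij: "d = (i, j)" by fastforce
  have jm: "j < m" using d by (simp add: cells_def ij)
  show "later t d < later (Suc t) d" using jm by (auto simp: ij later_def algebra_simps)
  {
    fix e assume e: "e \<in> cells" "L d \<le> L e"
    obtain i' j' where e': "e = (i', j')" by fastforce
    show "later t e \<noteq> later (Suc t) d"
    proof (cases "i = 0")
      case True
      have "later t e \<le> later t (0, m - 1)"
        using later_first_row[of e "m - 1" t] e by (cases "i' = 0") (auto simp: e' later_def cells_def)
      also have "\<dots> < later (Suc t) d" using jm True by (simp add: ij later_def algebra_simps of_nat_diff)
      finally show ?thesis by simp
    next
      case False
      then have "later (Suc t) d = later t d + 1" by (simp add: ij later_def)
      then show ?thesis using no_larger_ball_next[OF d _ e, of t] False ij by simp
    qed
  }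
  fix q assume q: "later t d < q" "q < later (Suc t) d"
  then have i: "i = 0" by (cases "i = 0") (auto simp: ij later_def)
  show "(\<exists>e\<in>cells. L e < L d \<and> later (Suc t) e = q) \<or> (\<exists>e\<in>cells. L d < L e \<and> later t e = q)"
  \<comment> \<open>The new first position of the block separates its old boxes from its new ones.\<close>
  proof (cases "q < later (Suc t) (0, 0)")
    case True
    define k where "k = nat (q - later t (0, 0))"
    have k: "int k = q - later t (0, 0)" using q by (simp add: k_def ij i later_def)
    then have "j < k" "k < m" using q True by (auto simp: ij i later_def algebra_simps)
    then have "(0, k) \<in> cells" "L d < L (0, k)"
      using first_row_cell[of k] first_row_increasing[of j k] by (auto simp: ij i)
    moreover have "later t (0, k) = q" using k by (simp add: later_def)
    ultimately show ?thesis by blast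
  next
    case False
    define k where "k = nat (q - later (Suc t) (0, 0))"
    have k: "int k = q - later (Suc t) (0, 0)" using False by (simp add: k_def)
    then have "k < j" using q by (simp add: ij i later_def)
    then have "(0, k) \<in> cells" "L (0, k) < L d"
      using first_row_cell[of k] first_row_increasing[of k j] jm by (auto simp: ij i)
    moreover have "later (Suc t) (0, k) = q" using k by (simp add: later_def)
    ultimately show ?thesis by blast
  qed
qed

section \<open>Solitons after the first move\<close>

lemma ball_at:
  assumes "represents (total m) cells L p X" "X q \<in> {1..total m}"
  obtains d where "d \<in> cells" "q = p d" "X q = L d"
proof (cases "q \<in> p ` cells")
  case True
  then show ?thesis using assms that by (auto simp: represents_def)
next
  case False
  then show ?thesis using assms by (auto simp: represents_def)
qed

lemma increasing_segment_shrink: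
  "increasing_segment n X a b \<Longrightarrow> a \<le> a' \<Longrightarrow> a' \<le> b' \<Longrightarrow> b' \<le> b \<Longrightarrow> increasing_segment n X a' b'"
  unfolding increasing_segment_def strict_mono_on_def by auto

text \<open>Segments of an increasing segment are increasing, so maximality needs to be tested only against
extensions by a single box.\<close>

lemma increasing_runI:
  assumes "increasing_segment n X a b"
    and "\<not> increasing_segment n X (a - 1) a" "\<not> increasing_segment n X b (b + 1)"
  shows "increasing_run n X (map X [a..b])"
proof -
  have "a' = a \<and> b' = b" if "a' \<le> a" "b \<le> b'" "increasing_segment n X a' b'" for a' b'
  proof -
    have "a \<le> b" using assms(1) by (simp add: increasing_segment_def)
    then show ?thesis
      using increasing_segment_shrink[OF that(3), of "a - 1" a]
        increasing_segment_shrink[OF that(3), of b "b + 1"] assms(2,3) that(1,2)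
      by force
  qed
  then show ?thesis unfolding increasing_run_def using assms(1) by blast
qed

lemma increasing_segment_pair:
  assumes "increasing_segment n X q (q + 1)"
  shows "X q \<in> {1..n}" "X (q + 1) \<in> {1..n}" "X q < X (q + 1)"
  using assms unfolding increasing_segment_def strict_mono_on_def by auto

text \<open>Both neighbours are excluded by the same fact, applied to the ball itself or to its left
neighbour, which is not in the first row because that row is further to the right.\<close>

lemma singleton_run:
  assumes X: "represents (total m) cells L (later t) X" and d: "d \<in> cells" "0 < fst d"
  shows "increasing_run (total m) X [L d]"
proof -
  have at: "X (later t d) = L d" using X d by (simp add: represents_def)
  have "increasing_run (total m) X (map X [later t d..later t d])"
  proof (rule increasing_runI)
    show "increasing_segment (total m) X (later t d) (later t d)"
      using at bij_betwE[OF label_bij] d by (auto simp: increasing_segment_def strict_mono_on_def)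
    show "\<not> increasing_segment (total m) X (later t d) (later t d + 1)"
    proof
      assume "increasing_segment (total m) X (later t d) (later t d + 1)"
      note p = increasing_segment_pair[OF this]
      obtain e where "e \<in> cells" "later t d + 1 = later t e" "X (later t d + 1) = L e"
        using ball_at[OF X p(2)] by blast
      then show False using no_larger_ball_next[OF d, of e t] p(3) at by simp
    qed
    show "\<not> increasing_segment (total m) X (later t d - 1) (later t d)"
    proof
      assume "increasing_segment (total m) X (later t d - 1) (later t d)"
      then have p: "X (later t d - 1) \<in> {1..total m}" "X (later t d - 1) < X (later t d)"
        using increasing_segment_pair[of "total m" X "later t d - 1"] by auto
      obtain e where e: "e \<in> cells" "later t d - 1 = later t e" "X (later t d - 1) = L e"
        using ball_at[OF X p(1)] by blast
      have "0 < fst e"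
        using later_first_row[OF d, of "snd e" t] e
        by (cases e) (auto simp: cells_def intro: ccontr)
      then show False using no_larger_ball_next[OF e(1) _ d(1), of t] e p(2) at by simp
    qed
  qed
  then show ?thesis using at by simp
qed

lemma first_row_run:
  assumes X: "represents (total m) cells L (later t) X" and "0 < m"
  shows "increasing_run (total m) X (map (\<lambda>j. L (0, j)) [0..<m])"
proof -
  define a where "a = later t (0, 0)"
  have at: "X (a + int j) = L (0, j)" if "j < m" for j
  proof -
    have "later t (0, j) = a + int j" by (simp add: a_def later_def)
    then show ?thesis using X first_row_cell[OF that] unfolding represents_def by metis
  qed
  have bound: "later t d < a + int m" if "d \<in> cells" for d
    using later_first_row[of d 0 t] that \<open>0 < m\<close>
    by (cases d; cases "fst d = 0") (auto simp: a_def later_def cells_def)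
  have "increasing_run (total m) X (map X [a..a + int m - 1])"
  proof (rule increasing_runI)
    show "increasing_segment (total m) X a (a + int m - 1)"
      unfolding increasing_segment_def strict_mono_on_def
    proof (intro conjI ballI allI impI)
      show "a \<le> a + int m - 1" using \<open>0 < m\<close> by simp
      have nth: "\<exists>j<m. q = a + int j" if "q \<in> {a..a + int m - 1}" for q
        using that by (intro exI[of _ "nat (q - a)"]) auto
      {
        fix q assume q: "q \<in> {a..a + int m - 1}"
        then obtain j where j: "j < m" "q = a + int j" using nth by blast
        show "X q \<in> {1..total m}"
          using at[OF j(1)] j(2) bij_betwE[OF label_bij] first_row_cell[OF j(1)] by auto
      }
      fix q r assume qr: "q \<in> {a..a + int m - 1} \<and> r \<in> {a..a + int m - 1} \<and> q < r"
      then obtain j k where "j < m" "q = a + int j" "k < m" "r = a + int k" using nth by blast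
      then show "X q < X r" using at qr first_row_increasing[of j k] by auto
    qed
    show "\<not> increasing_segment (total m) X (a - 1) a"
    proof
      assume "increasing_segment (total m) X (a - 1) a"
      then have p: "X (a - 1) \<in> {1..total m}" "X (a - 1) < X a"
        using increasing_segment_pair[of "total m" X "a - 1"] by auto
      obtain e where e: "e \<in> cells" "X (a - 1) = L e" using ball_at[OF X p(1)] by blast
      then show False using p(2) at[OF \<open>0 < m\<close>] first_row_le[of "fst e" "snd e" 0] by simp
    qed
    show "\<not> increasing_segment (total m) X (a + int m - 1) (a + int m - 1 + 1)"
    proof
      assume "increasing_segment (total m) X (a + int m - 1) (a + int m - 1 + 1)"
      note p = increasing_segment_pair(2)[OF this]
      obtain e where "e \<in> cells" "a + int m - 1 + 1 = later t e" using ball_at[OF X p] by blast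
      then show False using bound[of e] by simp
    qed
  qed
  moreover have "map X [a..a + int m - 1] = map (\<lambda>j. L (0, j)) [0..<m]"
    by (rule nth_equalityI) (auto simp: at)
  ultimately show ?thesis by simp
qed

text \<open>The solitons are the first row and the single balls of all other cells, rather than the
rows of the tableau.\<close>

lemma steady_state_later:
  assumes "represents (total m) cells L (later 0) X"
  shows "steady_state (total m) X"
  unfolding steady_state_def
proof
  fix b assume "b \<in> {1..total m}"
  then obtain d where d: "d \<in> cells" "b = L d" using label_bij by (metis bij_betw_imp_surj_on imageE)
  define s where "s = (if fst d = 0 then map (\<lambda>j. L (0, j)) [0..<m] else [L d])"
  have rep: "represents (total m) cells L (later t) ((BB (total m) ^^ t) X)" for t
    by (induction t) (use assms represents_later_move in auto)
  have "0 < m" using d by (auto simp: cells_def)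
  then have run: "increasing_run (total m) ((BB (total m) ^^ t) X) s" for t
    using first_row_run[OF rep] singleton_run[OF rep d(1)] by (simp add: s_def)
  have "soliton (total m) X s" using run[of 0] run by (simp add: soliton_def)
  moreover have "b \<in> set s" using d by (cases d) (auto simp: s_def cells_def)
  ultimately show "\<exists>s. soliton (total m) X s \<and> b \<in> set s" by blast
qed

lemma steady_state_after_one_move:
  "represents (total m) cells L initial X \<Longrightarrow> steady_state (total m) (BB (total m) X)"
  by (rule steady_state_later[OF represents_first_move])

end

section \<open>The steady-state time of column reading words\<close>

lemma concat_nth:
  "j < length xss \<Longrightarrow> r < length (xss ! j) \<Longrightarrow>
     concat xss ! ((\<Sum>k<j. length (xss ! k)) + r) = xss ! j ! r"
proof (induction xss arbitrary: j)
  case (Cons xs xss)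
  then show ?case
    by (cases j) (auto simp: nth_append sum.lessThan_Suc_shift simp del: sum.lessThan_Suc)
qed simp

lemma represents_column_reading_word:
  fixes cs :: "nat list list"
  defines "h \<equiv> \<lambda>j. length (cs ! j)"
  assumes "[] \<notin> set cs"
  shows "represents (column_diagram.total h (length cs)) (column_diagram.cells (length cs) h)
    (\<lambda>(i, j). cs ! j ! i) (column_diagram.initial h) (config_of (concat (map rev cs)))"
proof -
  interpret column_diagram "length cs" h
    using assms by unfold_locales (auto simp: h_def in_set_conv_nth)
  let ?w = "concat (map rev cs)"
  have len: "length ?w = total (length cs)"
    unfolding total_def by (simp add: length_concat comp_def h_def sum_list_sum_nth atLeast0LessThan)
  have at: "config_of ?w (initial (i, j)) = cs ! j ! i" if "(i, j) \<in> cells" for i j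
  proof -
    have ij: "j < length cs" "i < h j" using that by (auto simp: cells_def)
    have "initial (i, j) - 1 = int (total j + (h j - 1 - i))"
      using ij by (simp add: initial_def total_def of_nat_diff)
    then have "nat (initial (i, j) - 1) = total j + (h j - 1 - i)" by (simp only: nat_int)
    also have "total j = (\<Sum>k<j. length (map rev cs ! k))"
      unfolding total_def using ij by (intro sum.cong) (auto simp: h_def)
    finally have "?w ! nat (initial (i, j) - 1) = rev (cs ! j) ! (h j - 1 - i)"
      using concat_nth[of j "map rev cs" "h j - 1 - i"] ij by (simp add: h_def)
    then have "?w ! nat (initial (i, j) - 1) = cs ! j ! i" using ij by (simp add: rev_nth h_def)
    moreover have "1 \<le> initial (i, j)" "initial (i, j) \<le> int (length ?w)"
      using initial_bounds[OF that] initial_le[OF that] len by auto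
    ultimately show ?thesis by (simp add: config_of_def)
  qed
  moreover have "config_of ?w q = Suc (total (length cs))" if "q \<notin> initial ` cells" for q
  proof -
    have "\<not> (1 \<le> q \<and> q \<le> int (length ?w))"
      using that initial_cover[of "length cs" q] len by (metis dual_order.refl imageI zero_less_one order_less_le_trans)
    then show ?thesis using len by (auto simp: config_of_def)
  qed
  ultimately show ?thesis by (auto simp: represents_def)
qed

theorem steady_state_column_reading_word:
  assumes "distinct (concat cs)" "set (concat cs) = {1..length (concat cs)}"
    and "[] \<notin> set cs" "\<forall>c\<in>set cs. sorted_wrt (<) c"
    and "sorted_wrt (\<lambda>c d. c ! 0 < d ! 0) cs"
  shows "steady_state (length (concat cs)) (BB (length (concat cs)) (config_of (concat (map rev cs))))"
proof -
  define h where "h = (\<lambda>j. length (cs ! j))"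
  interpret column_diagram "length cs" h
    using assms by unfold_locales (auto simp: h_def in_set_conv_nth)
  let ?L = "\<lambda>(i, j). cs ! j ! i"
  have len: "length (concat cs) = total (length cs)"
    unfolding total_def by (simp add: length_concat h_def sum_list_sum_nth atLeast0LessThan)
  have "set (concat cs) = (\<Union>j<length cs. (\<lambda>i. cs ! j ! i) ` {..<h j})"
    by (simp add: h_def set_conv_nth[of cs] set_conv_nth[of "cs ! _"]) (auto simp: set_conv_nth)
  also have "\<dots> = ?L ` cells"
    by (force simp: cells_def)
  finally have image: "?L ` cells = set (concat cs)" by simp
  \<comment> \<open>There are as many cells as entries, so the entries of different cells differ.\<close>
  have "bij_betw (\<lambda>(j, i). (i, j)) (SIGMA j:{..<length cs}. {..<h j}) cells"
    by (auto simp: bij_betw_def inj_on_def cells_def image_iff)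
  then have "card cells = total (length cs)" "finite cells"
    using bij_betw_same_card bij_betw_finite by (force simp: total_def)+
  then have "card (?L ` cells) = card cells"
    using assms(1) image len by (metis distinct_card)
  then have "inj_on ?L cells" using \<open>finite cells\<close> by (rule eq_card_imp_inj_on[rotated])
  then have bij: "bij_betw ?L cells {1..total (length cs)}"
    using image assms(2) len by (simp add: bij_betw_def)
  interpret column_labelling "length cs" h ?L
    using bij assms(4,5) by unfold_locales (auto simp: sorted_wrt_iff_nth_less h_def)
  show ?thesis
    using steady_state_after_one_move represents_column_reading_word[OF assms(3)] len
    by (simp add: h_def)
qed

text \<open>A steady state at time 1 bounds the infimum that defines the steady-state time by 1.\<close>

theorem proposition6p19:
  fixes n :: nat and w :: "nat list"
  assumes "w \<in> permutations_of_set {1..n}"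
  shows "((\<exists>T. standard_tableau n T \<and> w = column_reading_word T) \<longleftrightarrow>
          (\<exists>\<mu>. integer_partition \<mu> \<and> recording_tableau w = column_superstandard \<mu>)) \<and>
         ((\<exists>T. standard_tableau n T \<and> w = column_reading_word T) \<longrightarrow>
          steady_state_time w \<in> {0, 1})"
proof (intro conjI impI)
  show "(\<exists>T. standard_tableau n T \<and> w = column_reading_word T) \<longleftrightarrow>
      (\<exists>\<mu>. integer_partition \<mu> \<and> recording_tableau w = column_superstandard \<mu>)"
    by (rule column_reading_word_iff_recording_tableau[OF assms])
next
  assume "\<exists>T. standard_tableau n T \<and> w = column_reading_word T"
  then obtain T where T: "standard_tableau n T" "w = column_reading_word T" by blast
  define cs where "cs = List.transpose T"
  have cs: "tableau_columns cs" and w: "w = concat (map rev cs)"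
    using tableau_columns_transpose[OF T(1)] T(2) by (simp_all add: cs_def column_reading_word_def)
  have ne: "[] \<notin> set cs"
    using cs by (force simp: tableau_columns_def integer_partition_def shape_def)
  have "mset (concat cs) = mset w" unfolding w by (induction cs) auto
  from mset_eq_setD[OF this] mset_eq_imp_distinct_iff[OF this] mset_eq_length[OF this]
  have content: "distinct (concat cs)" "set (concat cs) = {1..n}" "length (concat cs) = length w"
    using assms by (auto simp: permutations_of_set_def)
  moreover have "length w = n"
    using distinct_card[OF content(1)] content(2,3) by simp
  moreover have "sorted_wrt (\<lambda>c d. c ! 0 < d ! 0) cs"
    using cs ne unfolding tableau_columns_def
    by (auto intro: sorted_wrt_mono_rel[of cs "\<lambda>c d. \<forall>i<length d. c ! i < d ! i"])
  ultimately have "steady_state (length w) ((BB (length w) ^^ 1) (config_of w))"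
    using steady_state_column_reading_word[of cs] ne cs w by (simp add: tableau_columns_def)
  then have "steady_state_time w \<le> enat 1"
    unfolding steady_state_time_def by (intro Inf_lower) blast
  then show "steady_state_time w \<in> {0, 1}"
    by (cases "steady_state_time w") (auto simp: zero_enat_def one_enat_def le_Suc_eq)
qed

end
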